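(* Let $(G,B,m,w)$ be a connected weighted finite graph with boundary, where $G=(V,E)$. Let $\sigma_2$ be its second Steklov eigenvalue, and put $V_B=\sum_{x\in B}m_x$, $m_0=\min_{x\in B}m_x$, $w_0=\min_{e\in E}w_e$ and $d_B=\max\{d(x,y) : x,y\in B\}$. Suppose that $$\sigma_2=\frac{w_0\,V_B}{(V_B-m_0)^2\,d_B}.$$ Then: 1. $|B|=2$ and $m_x=m_0$ for $x\in B$; 2. there is a unique path $P: v_0\sim v_1\sim\cdots\sim v_{d_B}$ with $v_0,v_{d_B}\in B$; moreover, $w_{v_{i-1}v_i}=w_0$ for $i=1,2,\dots,d_B$; 3. $G$ is a comb over $P$.
   Context: A weighted graph with boundary is a quadruple $(G,B,m,w)$ where $G=(V,E)$ is a simple graph, $B\subset V$ (the boundary), $m:V\to(0,\infty)$ is the vertex-measure and $w:E\to(0,\infty)$ is the edge-weight. It is a connected finite one if $G$ is finite and connected. Edges between boundary vertices are allowed. Put $\Omega=V\setminus B$ (the interior). Extend $w$ to a symmetric function on $V\times V$ by $w_{xy}=w(\{x,y\})$ if $\{x,y\}\in E$ and $w_{xy}=0$ otherwise. Write $x\sim y$ if $\{x,y\}\in E$. Paths have pairwise distinct vertices, and a path is regarded as a subgraph of $G$ (so a path and its reversal are the same path): $P$ has vertices $v_0,\dots,v_{d_B}$ and edges $\{v_{i-1},v_i\}$, $1\le i\le d_B$. The distance $d(x,y)$ is the combinatorial graph distance (the least number of edges in a path from $x$ to $y$). The Laplacian of $u:V\to\mathbb{R}$ is $\Delta u(x)=\frac{1}{m_x}\sum_{y\in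 V}(u(y)-u(x))w_{xy}$ for $x\in V$. For $x\in B$ the outward normal derivative is $\frac{\partial u}{\partial n}(x)=\frac{1}{m_x}\sum_{y\in V}(u(x)-u(y))w_{xy}=-\Delta u(x)$. For $f\in\mathbb{R}^B$ let $u_f:V\to\mathbb{R}$ be the harmonic extension of $f$, i.e. the function with $u_f=f$ on $B$ and $\Delta u_f=0$ on $\Omega$. The Steklov operator $\Lambda:\mathbb{R}^B\to\mathbb{R}^B$ is $\Lambda(f)=\frac{\partial u_f}{\partial n}$. It is self-adjoint and nonnegative for the inner product $\langle f,g\rangle_B=\sum_{x\in B}f(x)g(x)m_x$, and its eigenvalues, listed with multiplicity, are $0=\sigma_1<\sigma_2\le\cdots\le\sigma_{|B|}$, the Steklov eigenvalues. One has $$\sigma_2=\min\left\{\frac{\sum_{\{x,y\}\in E}(u_f(x)-u_f(y))^2w_{xy}}{\sum_{x\in B}f(x)^2m_x} : 0\ne f\in\mathbb{R}^B,\ \sum_{x\in B}f(x)m_x=0\right\}.$$ By convention $\sigma_i=+\infty$ for $i>|B|$. Comb: let $G$ be a connected graph and $S$ a connected subgraph of $G$. For a vertex $x$ of $S$, let $G_x$ be the connected component containing $x$ of the graph $G-E(S)$ obtained from $G$ by deleting the edges of $S$ (keeping all vertices). $G$ is called a comb over $S$ if $G_x\cap G_y=\emptyset$ for any two different vertices $x,y$ of $S$. *)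

theory Defs
  imports "HOL-Analysis.Analysis"
begin

text \<open>A simple graph is a pair of a vertex set and a set of two-element edges.  In the weighted
  graphs \<open>(G, B, m, w)\<close> below the vertex set \<open>V\<close> of \<open>G\<close> is the universe of a finite type \<open>'v\<close>,
  so that real functions on \<open>V\<close> are the vectors of the Euclidean space \<open>real ^ 'v\<close>.\<close>

definition simple_graph :: "'v set \<Rightarrow> 'v set set \<Rightarrow> bool" where
  "simple_graph V E \<longleftrightarrow> (\<forall>e\<in>E. e \<subseteq> V \<and> card e = 2)"

definition graph_path :: "'v set set \<Rightarrow> 'v list \<Rightarrow> bool" where
  "graph_path E p \<longleftrightarrow>
     p \<noteq> [] \<and> distinct p \<and> (\<forall>i. Suc i < length p \<longrightarrow> {p ! i, p ! Suc i} \<in> E)"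

definition path_between :: "'v set set \<Rightarrow> 'v \<Rightarrow> 'v \<Rightarrow> 'v list \<Rightarrow> bool" where
  "path_between E x y p \<longleftrightarrow> graph_path E p \<and> hd p = x \<and> last p = y"

definition path_edges :: "'v list \<Rightarrow> 'v set set" where
  "path_edges p = {{p ! i, p ! Suc i} | i. Suc i < length p}"

text \<open>The path as a subgraph: a list and its reversal give the same pair.\<close>

definition path_subgraph :: "'v list \<Rightarrow> 'v set \<times> 'v set set" where
  "path_subgraph p = (set p, path_edges p)"

definition connected_graph :: "'v set \<Rightarrow> 'v set set \<Rightarrow> bool" where
  "connected_graph V E \<longleftrightarrow> V \<noteq> {} \<and> (\<forall>x\<in>V. \<forall>y\<in>V. \<exists>p. path_between E x y p)"

definition graph_dist :: "'v set set \<Rightarrow> 'v \<Rightarrow> 'v \<Rightarrow> nat" where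
  "graph_dist E x y = (LEAST n. \<exists>p. path_between E x y p \<and> length p = n + 1)"

definition component_of :: "'v set set \<Rightarrow> 'v \<Rightarrow> 'v set" where
  "component_of E x = {y. \<exists>p. path_between E x y p}"

text \<open>Components are given by their vertex sets: two subgraphs are disjoint iff their vertex sets
  are.\<close>

definition comb_over :: "'v set \<Rightarrow> 'v set set \<Rightarrow> 'v set \<times> 'v set set \<Rightarrow> bool" where
  "comb_over V E S \<longleftrightarrow>
     simple_graph V E \<and> connected_graph V E \<and>
     simple_graph (fst S) (snd S) \<and> connected_graph (fst S) (snd S) \<and>
     fst S \<subseteq> V \<and> snd S \<subseteq> E \<and>
     (\<forall>x\<in>fst S. \<forall>y\<in>fst S. x \<noteq> y \<longrightarrow>
        component_of (E - snd S) x \<inter> component_of (E - snd S) y = {})"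

definition weighted_graph_with_boundary ::
  "'v::finite set set \<Rightarrow> 'v set \<Rightarrow> ('v \<Rightarrow> real) \<Rightarrow> ('v set \<Rightarrow> real) \<Rightarrow> bool" where
  "weighted_graph_with_boundary E B m w \<longleftrightarrow>
     simple_graph UNIV E \<and> B \<subseteq> UNIV \<and> (\<forall>x. 0 < m x) \<and> (\<forall>e\<in>E. 0 < w e)"

definition weight :: "'v set set \<Rightarrow> ('v set \<Rightarrow> real) \<Rightarrow> 'v \<Rightarrow> 'v \<Rightarrow> real" where
  "weight E w x y = (if {x, y} \<in> E then w {x, y} else 0)"

definition laplacian ::
  "'v::finite set set \<Rightarrow> ('v \<Rightarrow> real) \<Rightarrow> ('v set \<Rightarrow> real) \<Rightarrow> real ^ 'v \<Rightarrow> 'v \<Rightarrow> real" where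
  "laplacian E m w u x = 1 / m x * (\<Sum>y\<in>UNIV. (u $ y - u $ x) * weight E w x y)"

definition normal_derivative ::
  "'v::finite set set \<Rightarrow> ('v \<Rightarrow> real) \<Rightarrow> ('v set \<Rightarrow> real) \<Rightarrow> real ^ 'v \<Rightarrow> 'v \<Rightarrow> real" where
  "normal_derivative E m w u x = 1 / m x * (\<Sum>y\<in>UNIV. (u $ x - u $ y) * weight E w x y)"

text \<open>\<open>\<real>\<^sup>B\<close> is realised as the subspace of functions on \<open>V\<close> that vanish off \<open>B\<close>.\<close>

definition boundary_functions :: "'v::finite set \<Rightarrow> (real ^ 'v) set" where
  "boundary_functions B = {f. \<forall>x. x \<notin> B \<longrightarrow> f $ x = 0}"

text \<open>Exists and is unique when \<open>G\<close> is connected and \<open>B\<close> is nonempty.\<close>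

definition harmonic_extension ::
  "'v::finite set set \<Rightarrow> 'v set \<Rightarrow> ('v \<Rightarrow> real) \<Rightarrow> ('v set \<Rightarrow> real) \<Rightarrow> real ^ 'v \<Rightarrow> real ^ 'v" where
  "harmonic_extension E B m w f =
     (THE u. (\<forall>x\<in>B. u $ x = f $ x) \<and> (\<forall>x\<in>UNIV - B. laplacian E m w u x = 0))"

definition steklov_operator ::
  "'v::finite set set \<Rightarrow> 'v set \<Rightarrow> ('v \<Rightarrow> real) \<Rightarrow> ('v set \<Rightarrow> real) \<Rightarrow> real ^ 'v \<Rightarrow> real ^ 'v" where
  "steklov_operator E B m w f =
     (\<chi> x. if x \<in> B then normal_derivative E m w (harmonic_extension E B m w f) x else 0)"

definition steklov_eigenspace ::
  "'v::finite set set \<Rightarrow> 'v set \<Rightarrow> ('v \<Rightarrow> real) \<Rightarrow> ('v set \<Rightarrow> real) \<Rightarrow> real \<Rightarrow> (real ^ 'v) set" where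
  "steklov_eigenspace E B m w s =
     {f \<in> boundary_functions B. steklov_operator E B m w f = s *\<^sub>R f}"

text \<open>All eigenvalues in increasing order, each repeated according to the dimension of its
  eigenspace.  As the operator is self-adjoint on \<open>\<real>\<^sup>B\<close>, this list has length \<open>card B\<close>.\<close>

definition steklov_spectrum ::
  "'v::finite set set \<Rightarrow> 'v set \<Rightarrow> ('v \<Rightarrow> real) \<Rightarrow> ('v set \<Rightarrow> real) \<Rightarrow> real list" where
  "steklov_spectrum E B m w =
     (THE l. sorted l \<and> (\<forall>s. count_list l s = dim (steklov_eigenspace E B m w s)))"

text \<open>The numbering starts at \<open>1\<close>.\<close>

definition steklov_eigenvalue ::
  "'v::finite set set \<Rightarrow> 'v set \<Rightarrow> ('v \<Rightarrow> real) \<Rightarrow> ('v set \<Rightarrow> real) \<Rightarrow> nat \<Rightarrow> ereal" where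
  "steklov_eigenvalue E B m w i =
     (if i \<le> card B then ereal (steklov_spectrum E B m w ! (i - 1)) else \<infinity>)"

definition boundary_volume :: "'v set \<Rightarrow> ('v \<Rightarrow> real) \<Rightarrow> real" where
  "boundary_volume B m = (\<Sum>x\<in>B. m x)"

definition min_boundary_measure :: "'v set \<Rightarrow> ('v \<Rightarrow> real) \<Rightarrow> real" where
  "min_boundary_measure B m = Min (m ` B)"

definition min_edge_weight :: "'v set set \<Rightarrow> ('v set \<Rightarrow> real) \<Rightarrow> real" where
  "min_edge_weight E w = Min (w ` E)"

definition boundary_diameter :: "'v set set \<Rightarrow> 'v set \<Rightarrow> nat" where
  "boundary_diameter E B = Max {graph_dist E x y | x y. x \<in> B \<and> y \<in> B}"

text \<open>Paths \<open>v\<^sub>0 \<sim> \<dots> \<sim> v\<^sub>d\<close> with \<open>d = d\<^sub>B\<close> edges and both end points in \<open>B\<close>.\<close>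

definition boundary_diameter_path :: "'v set set \<Rightarrow> 'v set \<Rightarrow> 'v list \<Rightarrow> bool" where
  "boundary_diameter_path E B p \<longleftrightarrow>
     graph_path E p \<and> length p = boundary_diameter E B + 1 \<and> hd p \<in> B \<and> last p \<in> B"

end

theory Submission
  imports Defs
begin

text \<open>Let \<open>f\<close> be an eigenfunction for \<open>\<sigma>\<^sub>2 > 0\<close> with harmonic extension \<open>u\<close>, and let \<open>D\<close> be the
  difference between the maximum and the minimum of \<open>f\<close>.  By Cauchy-Schwarz along a shortest path
  between the extremal points the energy of \<open>u\<close> is at least \<open>w\<^sub>0 D\<^sup>2 / d\<^sub>B\<close>, while
  \<open>\<Sum> f\<^sup>2 m \<le> V\<^sub>B D\<^sup>2 / 4\<close> because \<open>f\<close> has mean zero.  Hence \<open>\<sigma>\<^sub>2 \<ge> 4 w\<^sub>0 / (V\<^sub>B d\<^sub>B)\<close>, and the assumed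
  value of \<open>\<sigma>\<^sub>2\<close> forces \<open>V\<^sub>B \<le> 2 m\<^sub>0\<close>, that is, two boundary points of equal measure.  Then every
  path of length \<open>d\<^sub>B\<close> between them attains equality in Cauchy-Schwarz: its edges have weight \<open>w\<^sub>0\<close>,
  \<open>u\<close> is affine and nonconstant along it, and all the energy of \<open>u\<close> sits on it.  The last two
  properties give uniqueness of the path and the comb structure.\<close>

section \<open>Green's formula and the harmonic extension\<close>

text \<open>The sum over ordered pairs meets each edge twice, hence the factor 1/2: for
  \<open>u = v\<close> this is the numerator of the Rayleigh quotient.\<close>

definition dirichlet_form ::
  "'v::finite set set \<Rightarrow> ('v set \<Rightarrow> real) \<Rightarrow> real ^ 'v \<Rightarrow> real ^ 'v \<Rightarrow> real" where
  "dirichlet_form E w u v =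
     (\<Sum>x\<in>UNIV. \<Sum>y\<in>UNIV. (u $ x - u $ y) * (v $ x - v $ y) * weight E w x y) / 2"

definition boundary_inner :: "'v::finite set \<Rightarrow> ('v \<Rightarrow> real) \<Rightarrow> real ^ 'v \<Rightarrow> real ^ 'v \<Rightarrow> real" where
  "boundary_inner B m f g = (\<Sum>x\<in>B. f $ x * g $ x * m x)"

lemma weight_commute: "weight E w x y = weight E w y x"
  by (simp add: weight_def insert_commute)

text \<open>Exchanging the names of \<open>x\<close> and \<open>y\<close> gives a second expression
  for the left side; averaging the two symmetrises it.\<close>

lemma green_formula:
  "(\<Sum>x\<in>UNIV. v $ x * (\<Sum>y\<in>UNIV. (u $ x - u $ y) * weight E w x y)) = dirichlet_form E w u v"
proof -
  let ?S = "\<Sum>x\<in>UNIV. v $ x * (\<Sum>y\<in>UNIV. (u $ x - u $ y) * weight E w x y)"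
  have 1: "?S = (\<Sum>x\<in>UNIV. \<Sum>y\<in>UNIV. v $ x * (u $ x - u $ y) * weight E w x y)"
    by (simp add: sum_distrib_left mult.assoc)
  also have "\<dots> = (\<Sum>y\<in>UNIV. \<Sum>x\<in>UNIV. v $ x * (u $ x - u $ y) * weight E w x y)"
    by (rule sum.swap)
  finally have 2: "?S = (\<Sum>x\<in>UNIV. \<Sum>y\<in>UNIV. v $ y * (u $ y - u $ x) * weight E w x y)"
    by (simp add: weight_commute)
  have "2 * ?S = (\<Sum>x\<in>UNIV. \<Sum>y\<in>UNIV. v $ x * (u $ x - u $ y) * weight E w x y) +
      (\<Sum>x\<in>UNIV. \<Sum>y\<in>UNIV. v $ y * (u $ y - u $ x) * weight E w x y)"
    using 1 2 by linarith
  also have "\<dots> = (\<Sum>x\<in>UNIV. \<Sum>y\<in>UNIV. (u $ x - u $ y) * (v $ x - v $ y) * weight E w x y)"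
    by (simp add: sum.distrib[symmetric] algebra_simps)
  finally show ?thesis
    by (simp add: dirichlet_form_def)
qed

lemma dirichlet_form_commute: "dirichlet_form E w u v = dirichlet_form E w v u"
  by (simp add: dirichlet_form_def mult.commute mult.left_commute)

lemma constant_on_path:
  assumes "\<And>x y. {x, y} \<in> E \<Longrightarrow> g x = g y" "path_between E x y p"
  shows "g x = g y"
proof -
  have p: "p \<noteq> []" "\<And>i. Suc i < length p \<Longrightarrow> {p ! i, p ! Suc i} \<in> E" "hd p = x" "last p = y"
    using assms(2) by (auto simp: path_between_def graph_path_def)
  have "i < length p \<Longrightarrow> g (p ! i) = g x" for i
  proof (induction i)
    case 0
    then show ?case using p(1,3) by (simp add: hd_conv_nth)
  next
    case (Suc i)
    then show ?case using assms(1)[OF p(2)[of i]] by simp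
  qed
  from this[of "length p - 1"] show ?thesis
    using p(1,4) by (simp add: last_conv_nth)
qed

text \<open>Nonempty \<open>B\<close> fixes the additive constant that connectedness leaves free, so
  harmonic extensions are unique.\<close>

locale connected_weighted_graph =
  fixes E :: "'v::finite set set" and B :: "'v set"
    and m :: "'v \<Rightarrow> real" and w :: "'v set \<Rightarrow> real"
  assumes wgb: "weighted_graph_with_boundary E B m w"
    and conn: "connected_graph UNIV E"
    and B_nonempty: "B \<noteq> {}"
begin

abbreviation "ext \<equiv> harmonic_extension E B m w"
abbreviation "DtN \<equiv> steklov_operator E B m w"
abbreviation "energy \<equiv> dirichlet_form E w"
abbreviation "ip \<equiv> boundary_inner B m"

lemma m_pos: "0 < m x" and w_pos: "e \<in> E \<Longrightarrow> 0 < w e"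
  using wgb by (auto simp: weighted_graph_with_boundary_def)

lemma weight_nonneg: "0 \<le> weight E w x y"
  using w_pos by (auto simp: weight_def less_imp_le)

lemma energy_zero_imp_constant:
  assumes "energy u u = 0"
  shows "u $ x = u $ y"
proof -
  have "(\<Sum>x\<in>UNIV. \<Sum>y\<in>UNIV. (u $ x - u $ y)\<^sup>2 * weight E w x y) = 0"
    using assms by (simp add: dirichlet_form_def power2_eq_square)
  then have z: "(u $ x - u $ y)\<^sup>2 * weight E w x y = 0" for x y
    by (simp add: sum_nonneg_eq_0_iff sum_nonneg weight_nonneg)
  have "u $ x = u $ y" if "{x, y} \<in> E" for x y
    using z[of x y] that w_pos[OF that] by (simp add: weight_def)
  moreover obtain p where "path_between E x y p"
    using conn by (auto simp: connected_graph_def)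
  ultimately show ?thesis
    using constant_on_path[of E "\<lambda>x. u $ x"] by blast
qed

text \<open>Finite dimension reduces existence of the harmonic extension to its uniqueness.\<close>

lemma harmonic_extension_ex1:
  "\<exists>!u. (\<forall>x\<in>B. u $ x = f $ x) \<and> (\<forall>x\<in>UNIV - B. laplacian E m w u x = 0)"
proof -
  \<comment> \<open>\<open>T\<close> records boundary values on \<open>B\<close> and the Laplacian
    elsewhere, turning the Dirichlet problem into one square linear system.\<close>
  define T :: "real ^ 'v \<Rightarrow> real ^ 'v"
    where "T u = (\<chi> x. if x \<in> B then u $ x else laplacian E m w u x)" for u
  have lin: "linear T"
    by (rule linearI) (auto simp: T_def laplacian_def vec_eq_iff algebra_simps sum.distrib
        sum_distrib_left sum_subtractf)
  have "u = 0" if "T u = 0" for u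
  proof -
    have B: "u $ x = 0" if "x \<in> B" for x
      using \<open>T u = 0\<close> that by (auto simp: T_def vec_eq_iff split: if_splits)
    have "laplacian E m w u x = 0" if "x \<notin> B" for x
      using \<open>T u = 0\<close> that by (auto simp: T_def vec_eq_iff split: if_splits)
    then have "(\<Sum>y\<in>UNIV. (u $ y - u $ x) * weight E w x y) = 0" if "x \<notin> B" for x
      using that m_pos[of x] unfolding laplacian_def by fastforce
    then have "(\<Sum>y\<in>UNIV. (u $ x - u $ y) * weight E w x y) = 0" if "x \<notin> B" for x
      using that by (simp add: left_diff_distrib sum_subtractf)
    \<comment> \<open>In Green's formula with \<open>v = u\<close> each summand vanishes: on
      \<open>B\<close> through \<open>u $ x = 0\<close>, elsewhere through harmonicity.\<close>
    with B have "energy u u = 0"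
      unfolding green_formula[symmetric] by (intro sum.neutral) auto
    then have "u $ x = u $ y" for x y
      by (rule energy_zero_imp_constant)
    with B B_nonempty show "u = 0"
      by (metis all_not_in_conv vec_eq_iff zero_index)
  qed
  then have inj: "inj T"
    using lin by (simp add: linear_injective_0)
  then have "surj T"
    using linear_injective_imp_surjective[OF lin] by simp
  then obtain u where u: "T u = (\<chi> x. if x \<in> B then f $ x else 0)"
    by (metis surjD)
  have T_iff: "T v = (\<chi> x. if x \<in> B then f $ x else 0) \<longleftrightarrow>
      (\<forall>x\<in>B. v $ x = f $ x) \<and> (\<forall>x\<in>UNIV - B. laplacian E m w v x = 0)" for v
    by (auto simp: T_def vec_eq_iff)
  show ?thesis
    using u inj unfolding T_iff[symmetric] by (metis injD)
qed

lemma ext_boundary: "x \<in> B \<Longrightarrow> ext f $ x = f $ x"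
  and ext_harmonic: "x \<notin> B \<Longrightarrow> laplacian E m w (ext f) x = 0"
  using theI'[OF harmonic_extension_ex1[of f]] unfolding harmonic_extension_def by auto

lemma ext_eqI:
  assumes "\<And>x. x \<in> B \<Longrightarrow> u $ x = f $ x" "\<And>x. x \<notin> B \<Longrightarrow> laplacian E m w u x = 0"
  shows "ext f = u"
  using harmonic_extension_ex1[of f] assms ext_boundary ext_harmonic
  by (metis DiffD2)

lemma linear_ext: "linear ext"
proof (rule linearI)
  fix f g
  have "laplacian E m w (ext f + ext g) x = laplacian E m w (ext f) x + laplacian E m w (ext g) x" for x
    by (simp add: laplacian_def algebra_simps sum.distrib sum_subtractf)
  then show "ext (f + g) = ext f + ext g"
    by (intro ext_eqI) (auto simp: ext_boundary ext_harmonic)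
next
  fix c f
  have "laplacian E m w (c *\<^sub>R ext f) x = c * laplacian E m w (ext f) x" for x
    by (simp add: laplacian_def algebra_simps sum_distrib_left sum_subtractf)
  then show "ext (c *\<^sub>R f) = c *\<^sub>R ext f"
    by (intro ext_eqI) (auto simp: ext_boundary ext_harmonic)
qed

lemma linear_DtN: "linear DtN"
  by (rule linearI)
    (auto simp: steklov_operator_def normal_derivative_def vec_eq_iff linear_add[OF linear_ext]
      linear_scale[OF linear_ext] algebra_simps sum.distrib sum_subtractf sum_distrib_left)

lemma DtN_boundary: "DtN f \<in> boundary_functions B"
  by (simp add: steklov_operator_def boundary_functions_def)

text \<open>Green's formula with both arguments harmonic: only vertices of \<open>B\<close>
  contribute, and there \<open>m x\<close> cancels the factor \<open>1 / m x\<close> of the normal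
  derivative. Self-adjointness follows by symmetry of the energy.\<close>

lemma ip_DtN: "ip (DtN f) g = energy (ext f) (ext g)"
proof -
  let ?N = "\<lambda>x. \<Sum>y\<in>UNIV. (ext f $ x - ext f $ y) * weight E w x y"
  have "?N x = 0" if "x \<notin> B" for x
    using ext_harmonic[OF that, of f] m_pos[of x]
    by (simp add: laplacian_def left_diff_distrib sum_subtractf)
  then have "energy (ext f) (ext g) = (\<Sum>x\<in>B. ext g $ x * ?N x)"
    unfolding green_formula[symmetric] by (intro sum.mono_neutral_right) auto
  also have "\<dots> = ip (DtN f) g"
    unfolding boundary_inner_def
  proof (rule sum.cong[OF refl])
    fix x assume "x \<in> B"
    then show "ext g $ x * ?N x = DtN f $ x * g $ x * m x"
      using m_pos[of x] by (simp add: ext_boundary steklov_operator_def normal_derivative_def)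
  qed
  finally show ?thesis by simp
qed

section \<open>The Steklov spectrum\<close>

lemma ip_commute: "ip f g = ip g f"
  by (simp add: boundary_inner_def mult.commute)

lemma ip_add: "ip (f + g) h = ip f h + ip g h"
  and ip_diff: "ip (f - g) h = ip f h - ip g h"
  and ip_scale: "ip (c *\<^sub>R f) h = c * ip f h"
  and ip_scale_right: "ip h (c *\<^sub>R f) = c * ip h f"
  by (simp_all add: boundary_inner_def sum.distrib sum_subtractf sum_distrib_left algebra_simps)

lemma DtN_symmetric: "ip (DtN f) g = ip f (DtN g)"
  by (metis ip_DtN ip_commute dirichlet_form_commute)

lemma ip_pos:
  assumes "f \<in> boundary_functions B" "f \<noteq> 0"
  shows "0 < ip f f"
proof -
  obtain x where x: "f $ x \<noteq> 0" "x \<in> B"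
    using assms by (force simp: boundary_functions_def vec_eq_iff)
  have "0 < f $ x * f $ x * m x"
    using x(1) m_pos[of x] by (metis mult_pos_pos not_real_square_gt_zero)
  also have "\<dots> \<le> ip f f"
    unfolding boundary_inner_def
    by (intro member_le_sum x mult_nonneg_nonneg[OF zero_le_square]) (auto simp: m_pos less_imp_le)
  finally show ?thesis .
qed

text \<open>Orthogonality refers to the weighted form \<open>ip\<close>. A vector in the span of the
  others would be orthogonal to itself, against \<open>ip_pos\<close>.\<close>

lemma orthogonal_imp_independent:
  assumes A: "A \<subseteq> boundary_functions B" "0 \<notin> A"
    and orth: "\<And>f g. f \<in> A \<Longrightarrow> g \<in> A \<Longrightarrow> f \<noteq> g \<Longrightarrow> ip f g = 0"
  shows "independent A"
  unfolding dependent_def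
proof
  assume "\<exists>a\<in>A. a \<in> span (A - {a})"
  then obtain a where a: "a \<in> A" "a \<in> span (A - {a})" by blast
  have "subspace {f. ip f a = 0}"
    by (auto simp: subspace_def ip_add ip_scale) (simp add: boundary_inner_def)
  moreover have "A - {a} \<subseteq> {f. ip f a = 0}"
    using orth a by auto
  ultimately have "ip a a = 0"
    using span_minimal a(2) by blast
  with ip_pos[of a] a(1) A show False by force
qed

abbreviation "eigenspace \<equiv> steklov_eigenspace E B m w"

lemma eigenspace_orthogonal:
  assumes "f \<in> eigenspace s" "g \<in> eigenspace t" "s \<noteq> t"
  shows "ip f g = 0"
proof -
  have "s * ip f g = t * ip f g"
    using DtN_symmetric[of f g] assms
    by (simp add: steklov_eigenspace_def ip_scale ip_scale_right)
  with assms(3) show ?thesis by simp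
qed

text \<open>Choosing one nonzero eigenvector per eigenvalue gives an independent family in a
  finite-dimensional space. Finiteness lets the multiplicities form a multiset.\<close>

lemma finite_eigenvalues: "finite {s. 0 < dim (eigenspace s)}"
proof -
  let ?S = "{s. 0 < dim (eigenspace s)}"
  have "\<exists>f\<in>eigenspace s. f \<noteq> 0" if "s \<in> ?S" for s
  proof (rule ccontr)
    assume "\<not> ?thesis"
    then have "eigenspace s \<subseteq> {0}" by auto
    then have "dim (eigenspace s) = 0" by simp
    with that show False by simp
  qed
  then obtain F where F: "\<And>s. s \<in> ?S \<Longrightarrow> F s \<in> eigenspace s \<and> F s \<noteq> 0"
    by metis
  have bf: "F s \<in> boundary_functions B" if "s \<in> ?S" for s
    using F[OF that] by (simp add: steklov_eigenspace_def)
  have orth: "ip (F s) (F t) = 0" if "s \<in> ?S" "t \<in> ?S" "s \<noteq> t" for s t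
    using eigenspace_orthogonal that F[OF that(1)] F[OF that(2)] by blast
  have inj: "inj_on F ?S"
  proof (rule inj_onI, rule ccontr)
    fix s t assume "s \<in> ?S" "t \<in> ?S" "F s = F t" "s \<noteq> t"
    then have "ip (F s) (F s) = 0"
      using orth[of s t] by simp
    with ip_pos[of "F s"] bf F \<open>s \<in> ?S\<close> show False
      by (metis less_irrefl)
  qed
  have "independent (F ` ?S)"
  proof (rule orthogonal_imp_independent)
    show "F ` ?S \<subseteq> boundary_functions B"
      using bf by blast
    show "0 \<notin> F ` ?S"
      using F by (metis imageE)
    fix f g assume "f \<in> F ` ?S" "g \<in> F ` ?S" "f \<noteq> g"
    then show "ip f g = 0"
      using orth by blast
  qed
  then show ?thesis
    using inj independent_imp_finite finite_imageD by blast
qed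

text \<open>The definite description is legitimate: sorting the multiset of multiplicities gives
  such a list, and a sorted list is determined by its multiset.\<close>

lemma steklov_spectrum_properties:
  "sorted (steklov_spectrum E B m w)"
  "count_list (steklov_spectrum E B m w) s = dim (eigenspace s)"
proof -
  let ?P = "\<lambda>l. sorted l \<and> (\<forall>s. count_list l s = dim (eigenspace s))"
  define M where "M = Abs_multiset (\<lambda>s. dim (eigenspace s))"
  have "count M s = dim (eigenspace s)" for s
    unfolding M_def by (subst Abs_multiset_inverse) (simp_all add: finite_eigenvalues)
  then have ex: "?P (sorted_list_of_multiset M)"
    by (simp flip: count_mset)
  have uniq: "l = l'" if "?P l" "?P l'" for l l'
  proof -
    have "mset l = mset l'"
      using that by (intro multiset_eqI) (simp add: count_mset)
    with that show ?thesis
      by (metis properties_for_sort)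
  qed
  have "?P (steklov_spectrum E B m w)"
    unfolding steklov_spectrum_def by (rule theI) (use ex uniq in blast)+
  then show "sorted (steklov_spectrum E B m w)"
    "count_list (steklov_spectrum E B m w) s = dim (eigenspace s)"
    by auto
qed

text \<open>The constant 1 in the realisation of functions on \<open>B\<close>; orthogonality to it
  is the mean-zero condition.\<close>

definition boundary_one :: "real ^ 'v" where
  "boundary_one = (\<chi> x. if x \<in> B then 1 else 0)"

lemma boundary_one_eigenspace: "boundary_one \<in> eigenspace 0"
proof -
  have "ext boundary_one = (\<chi> x. 1)"
    by (rule ext_eqI) (auto simp: boundary_one_def laplacian_def)
  then show ?thesis
    by (simp add: steklov_eigenspace_def boundary_functions_def boundary_one_def
        steklov_operator_def normal_derivative_def vec_eq_iff)
qed

lemma ip_boundary_one: "ip f boundary_one = (\<Sum>x\<in>B. f $ x * m x)"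
  by (simp add: boundary_inner_def boundary_one_def)

lemma ip_DtN_boundary_one: "ip (DtN f) boundary_one = 0"
  using boundary_one_eigenspace
  by (simp add: DtN_symmetric steklov_eigenspace_def) (simp add: boundary_inner_def)

lemma boundary_one_nonzero: "boundary_one \<noteq> 0"
  using B_nonempty by (auto simp: boundary_one_def vec_eq_iff)

end

text \<open>The first-order condition at a zero of a nonnegative quadratic form.\<close>

lemma nonneg_quadratic_imp_zero:
  fixes b c :: real
  assumes "\<And>t. 0 \<le> 2 * t * b + t\<^sup>2 * c"
  shows "b = 0"
proof (rule ccontr)
  assume b: "b \<noteq> 0"
  \<comment> \<open>\<open>C\<close> is a positive upper bound of \<open>c\<close> whatever the sign
    of \<open>c\<close>, so \<open>t = - b / C\<close> minimises the majorant
    \<open>2 * t * b + t^2 * C\<close>.\<close>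
  define C where "C = \<bar>c\<bar> + 1"
  have C: "0 < C" "c \<le> C" by (auto simp: C_def)
  have "0 \<le> 2 * (- b / C) * b + (- b / C)\<^sup>2 * c"
    by (rule assms)
  also have "\<dots> \<le> 2 * (- b / C) * b + (- b / C)\<^sup>2 * C"
    by (intro add_left_mono mult_left_mono C) simp
  also have "\<dots> = - (b\<^sup>2 / C)"
    using C by (simp add: power2_eq_square field_simps)
  also have "\<dots> < 0"
    using C b by simp
  finally show False by simp
qed

section \<open>A nonconstant eigenvector from the Rayleigh quotient\<close>

context connected_weighted_graph
begin

text \<open>The Rayleigh quotient attains its minimum on the unit sphere of the mean-zero space, and
  the first-order condition turns a minimiser into an eigenvector.\<close>

lemma exists_mean_zero_eigenvector:
  assumes "2 \<le> card B"
  obtains f s where "f \<in> eigenspace s" "f \<noteq> 0" "ip f boundary_one = 0"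
proof -
  define W where "W = {f \<in> boundary_functions B. ip f boundary_one = 0}"
  have W: "subspace W"
    by (auto simp: W_def subspace_def ip_add ip_scale boundary_functions_def)
      (simp add: boundary_inner_def)
  define q where "q f = energy (ext f) (ext f) / ip f f" for f
  have pos: "0 < ip f f" if "f \<in> W" "f \<noteq> 0" for f
    using that ip_pos by (simp add: W_def)
  have q_scale: "q (c *\<^sub>R f) = q f" if "c \<noteq> 0" for c f
    using that by (simp add: q_def ip_DtN[symmetric] linear_scale[OF linear_DtN] ip_scale
        ip_scale_right)
  have norm_in: "(1 / norm f) *\<^sub>R f \<in> W \<inter> sphere 0 1" if "f \<in> W" "f \<noteq> 0" for f
    using that W by (simp add: subspace_scale)
  obtain a b where ab: "a \<in> B" "b \<in> B" "a \<noteq> b"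
    using assms card_le_Suc0_iff_eq[of B] by fastforce
  \<comment> \<open>A nonzero mean-zero function: the reciprocal measures at two boundary points
    cancel.\<close>
  define h :: "real ^ 'v"
    where "h = (\<chi> x. if x = a then 1 / m a else if x = b then - 1 / m b else 0)"
  have "ip h boundary_one = (\<Sum>x\<in>{a, b}. h $ x * m x)"
    unfolding ip_boundary_one by (rule sum.mono_neutral_right) (use ab in \<open>auto simp: h_def\<close>)
  then have "h \<in> W"
    using ab m_pos[of a] m_pos[of b]
    by (auto simp: W_def boundary_functions_def h_def)
  moreover have "h \<noteq> 0"
    using m_pos[of a] by (auto simp: h_def vec_eq_iff intro!: exI[of _ a])
  ultimately have "W \<inter> sphere 0 1 \<noteq> {}"
    using norm_in by blast
  moreover have "compact (W \<inter> sphere 0 1)"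
    using W by (simp add: closed_Int_compact closed_subspace)
  moreover have "continuous_on (W \<inter> sphere 0 1) q"
  proof -
    have "continuous_on S ext" for S
      using linear_ext by (simp add: linear_continuous_on linear_conv_bounded_linear)
    then show ?thesis
      unfolding q_def dirichlet_form_def boundary_inner_def
    proof (intro continuous_intros ballI)
      fix f assume "f \<in> W \<inter> sphere 0 1"
      then have "0 < ip f f"
        by (intro pos) auto
      then show "(\<Sum>x\<in>B. f $ x * f $ x * m x) \<noteq> 0"
        by (simp add: boundary_inner_def)
    qed auto
  qed
  ultimately obtain f where f: "f \<in> W \<inter> sphere 0 1" and
    f_min: "\<And>g. g \<in> W \<inter> sphere 0 1 \<Longrightarrow> q f \<le> q g"
    using continuous_attains_inf[of "W \<inter> sphere 0 1" q] by blast
  have fW: "f \<in> W" and f0: "f \<noteq> 0"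
    using f by auto
  \<comment> \<open>The bilinear form of \<open>DtN\<close> shifted by the minimum
    \<open>q f\<close>. Minimality makes it nonnegative on \<open>W\<close>, with value 0 at
    \<open>f\<close>.\<close>
  define R where "R g k = ip (DtN g - q f *\<^sub>R g) k" for g k
  have R_nonneg: "0 \<le> R g g" if "g \<in> W" for g
  proof (cases "g = 0")
    case True
    then show ?thesis by (simp add: R_def boundary_inner_def)
  next
    case False
    have "q f \<le> q ((1 / norm g) *\<^sub>R g)"
      using f_min norm_in that False by blast
    then have "q f \<le> q g"
      using False by (simp add: q_scale)
    then show ?thesis
      using pos[OF that False]
      by (simp add: q_def R_def ip_diff ip_scale ip_DtN field_simps)
  qed
  have R_commute: "R g k = R k g" for g k
    using DtN_symmetric[of g k] ip_commute[of g "DtN k"] ip_commute[of g k]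
    by (simp add: R_def ip_diff ip_scale)
  have R_f: "R f f = 0"
    using pos[OF fW f0] by (simp add: R_def q_def ip_diff ip_scale ip_DtN)
  \<comment> \<open>The residual of the eigenvalue equation is itself an admissible direction, as
    \<open>DtN f\<close> has mean zero; testing with it gives \<open>R f r = ip r r\<close>.\<close>
  define r where "r = DtN f - q f *\<^sub>R f"
  have "r \<in> boundary_functions B"
    using DtN_boundary[of f] fW by (auto simp: r_def W_def boundary_functions_def)
  moreover have "ip r boundary_one = 0"
    using fW by (simp add: r_def ip_diff ip_scale ip_DtN_boundary_one W_def)
  ultimately have rW: "r \<in> W"
    by (simp add: W_def)
  have "R f r = 0"
  proof (rule nonneg_quadratic_imp_zero)
    fix t
    have add: "R (g + k) l = R g l + R k l" and scale: "R (c *\<^sub>R g) l = c * R g l" for g k l c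
      by (simp_all add: R_def linear_add[OF linear_DtN] linear_scale[OF linear_DtN]
          ip_add ip_diff ip_scale algebra_simps)
    have add_right: "R l (g + k) = R l g + R l k" and scale_right: "R l (c *\<^sub>R g) = c * R l g"
      for g k l c
      using add scale R_commute by metis+
    have "0 \<le> R (f + t *\<^sub>R r) (f + t *\<^sub>R r)"
      using W fW rW by (intro R_nonneg) (simp add: subspace_add subspace_scale)
    also have "\<dots> = R f f + 2 * t * R f r + t\<^sup>2 * R r r"
      by (simp add: add scale add_right scale_right R_commute[of r f] power2_eq_square
          algebra_simps)
    finally show "0 \<le> 2 * t * R f r + t\<^sup>2 * R r r"
      using R_f by simp
  qed
  then have "ip r r = 0"
    by (simp add: R_def r_def)
  then have "r = 0"
    using pos[OF rW] by force
  then have "f \<in> eigenspace (q f)"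
    using fW by (simp add: r_def W_def steklov_eigenspace_def)
  then show thesis
    using that f0 fW by (simp add: W_def)
qed

lemma eigenvector_imp_in_spectrum:
  assumes "f \<in> eigenspace s" "f \<noteq> 0"
  shows "s \<in> set (steklov_spectrum E B m w)"
proof -
  have "dim (eigenspace s) \<noteq> 0"
    using assms by auto
  then show ?thesis
    by (metis steklov_spectrum_properties(2) count_list_0_iff)
qed

text \<open>This makes index 1 of the list valid. Constants and a mean-zero eigenvector count as two
  entries, either by multiplicity in the eigenspace of 0 or as distinct eigenvalues.\<close>

lemma two_le_length_spectrum:
  assumes "2 \<le> card B"
  shows "2 \<le> length (steklov_spectrum E B m w)"
proof -
  let ?l = "steklov_spectrum E B m w"
  obtain f s where f: "f \<in> eigenspace s" "f \<noteq> 0" "ip f boundary_one = 0"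
    using exists_mean_zero_eigenvector[OF assms] .
  note one = boundary_one_eigenspace boundary_one_nonzero
  show ?thesis
  proof (cases "s = 0")
    case True
    have bf: "boundary_one \<in> boundary_functions B" "f \<in> boundary_functions B"
      using one(1) f(1) by (auto simp: steklov_eigenspace_def)
    then have ne: "f \<noteq> boundary_one"
      using f(2,3) ip_pos by force
    have "independent {f, boundary_one}"
      by (rule orthogonal_imp_independent)
        (use f one bf ip_commute in auto)
    then have "card {f, boundary_one} \<le> dim (eigenspace 0)"
      using f(1) one(1) True by (intro independent_card_le_dim) auto
    then have "2 \<le> count_list ?l 0"
      using ne by (simp add: steklov_spectrum_properties)
    then show ?thesis
      by (rule order_trans[OF _ count_le_length])
  next
    case False
    have "card {0, s} \<le> card (set ?l)"
      using eigenvector_imp_in_spectrum f one by (intro card_mono) auto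
    then show ?thesis
      using False card_length[of ?l] by simp
  qed
qed

text \<open>The second eigenvalue is the entry with index 1. Since \<open>s \<noteq> 0\<close>, its
  eigenvectors are orthogonal to constants; the energy identity is \<open>ip_DtN\<close> with
  \<open>DtN f = s *\<^sub>R f\<close>.\<close>

lemma second_eigenvector:
  assumes "2 \<le> card B" "steklov_eigenvalue E B m w 2 = ereal s" "s \<noteq> 0"
  obtains f where "f \<in> boundary_functions B" "f \<noteq> 0" "(\<Sum>x\<in>B. f $ x * m x) = 0"
    "energy (ext f) (ext f) = s * (\<Sum>x\<in>B. (f $ x)\<^sup>2 * m x)"
proof -
  let ?l = "steklov_spectrum E B m w"
  have "s = ?l ! 1"
    using assms by (simp add: steklov_eigenvalue_def)
  then have "s \<in> set ?l"
    using two_le_length_spectrum[OF assms(1)] by simp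
  then have "dim (eigenspace s) \<noteq> 0"
    by (metis steklov_spectrum_properties(2) count_list_0_iff)
  then obtain f where f: "f \<in> eigenspace s" "f \<noteq> 0"
    by (metis dim_eq_0 singletonI subsetI singleton_iff)
  show thesis
  proof
    show "f \<in> boundary_functions B" "f \<noteq> 0"
      using f by (auto simp: steklov_eigenspace_def)
    show "(\<Sum>x\<in>B. f $ x * m x) = 0"
      using eigenspace_orthogonal[OF f(1) boundary_one_eigenspace assms(3)]
      by (simp add: ip_boundary_one)
    show "energy (ext f) (ext f) = s * (\<Sum>x\<in>B. (f $ x)\<^sup>2 * m x)"
      using f(1) ip_DtN[of f f]
      by (simp add: steklov_eigenspace_def ip_scale) (simp add: boundary_inner_def power2_eq_square)
  qed
qed

section \<open>Energy along a path\<close>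

lemma energy_split_path:
  assumes p: "graph_path E p" and d: "length p = Suc d"
  obtains r where "0 \<le> r"
    "energy u u = (\<Sum>i<d. (u $ (p ! Suc i) - u $ (p ! i))\<^sup>2 * w {p ! i, p ! Suc i}) + r"
    "\<And>x y. r = 0 \<Longrightarrow> {x, y} \<in> E - path_edges p \<Longrightarrow> u $ x = u $ y"
proof -
  have dist: "distinct p" and edge: "\<And>i. i < d \<Longrightarrow> {p ! i, p ! Suc i} \<in> E"
    using p d by (auto simp: graph_path_def)
  define c where "c = (\<lambda>(x, y). (u $ x - u $ y)\<^sup>2 * weight E w x y)"
  have c_nonneg: "0 \<le> c z" for z
    by (auto simp: c_def weight_nonneg split: prod.split)
  \<comment> \<open>\<open>P\<close> and \<open>N\<close> are the path edges traversed forwards and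
    backwards. Distinct vertices make them disjoint; the remaining ordered pairs give
    \<open>r\<close>.\<close>
  define P where "P = (\<lambda>i. (p ! i, p ! Suc i)) ` {..<d}"
  define N where "N = (\<lambda>i. (p ! Suc i, p ! i)) ` {..<d}"
  let ?S = "\<Sum>i<d. (u $ (p ! Suc i) - u $ (p ! i))\<^sup>2 * w {p ! i, p ! Suc i}"
  have nth_eq: "p ! i = p ! j \<longleftrightarrow> i = j" if "i \<le> d" "j \<le> d" for i j
    using that dist d by (simp add: nth_eq_iff_index_eq)
  have "P \<inter> N = {}"
    by (auto simp: P_def N_def nth_eq)
  have "sum c P = ?S"
    unfolding P_def
    by (subst sum.reindex)
      (auto intro!: sum.cong inj_onI simp: nth_eq c_def weight_def edge power2_commute)
  moreover have "sum c N = ?S"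
    unfolding N_def
    by (subst sum.reindex)
      (auto intro!: sum.cong inj_onI simp: nth_eq c_def weight_def edge insert_commute)
  ultimately have PN: "sum c (P \<union> N) = 2 * ?S"
    using \<open>P \<inter> N = {}\<close> by (subst sum.union_disjoint) (auto simp: P_def N_def)
  have "energy u u = sum c UNIV / 2"
    by (simp add: dirichlet_form_def c_def power2_eq_square sum.cartesian_product UNIV_Times_UNIV)
  also have "\<dots> = ?S + sum c (- (P \<union> N)) / 2"
    using PN sum.subset_diff[of "P \<union> N" UNIV c] by (simp add: Compl_eq_Diff_UNIV)
  finally have energy: "energy u u = ?S + sum c (- (P \<union> N)) / 2" .
  show thesis
  proof
    show "0 \<le> sum c (- (P \<union> N)) / 2"
      by (simp add: sum_nonneg c_nonneg)
    show "energy u u = ?S + sum c (- (P \<union> N)) / 2"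
      by (rule energy)
    fix x y
    assume r: "sum c (- (P \<union> N)) / 2 = 0" and xy: "{x, y} \<in> E - path_edges p"
    have "(x, y) \<in> - (P \<union> N)"
      using xy d by (auto simp: P_def N_def path_edges_def insert_commute)
    moreover have "\<forall>z \<in> - (P \<union> N). c z = 0"
      using r by (subst sum_nonneg_eq_0_iff[symmetric]) (auto simp: c_nonneg)
    ultimately have "c (x, y) = 0" by blast
    then show "u $ x = u $ y"
      using xy w_pos[of "{x, y}"] by (auto simp: c_def weight_def)
  qed
qed

text \<open>Cauchy-Schwarz in the form of an identity: the energy is the bound plus the excess of
  the weights over \<open>w0\<close>, the variance of the increments and the energy off the path.
  All three are nonnegative, so equality kills each.\<close>

lemma path_energy:
  assumes p: "graph_path E p" and d: "length p = Suc d" "0 < d"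
    and w0: "0 < w0" "\<And>e. e \<in> E \<Longrightarrow> w0 \<le> w e"
    and D: "D = u $ last p - u $ hd p"
  shows "w0 * D\<^sup>2 / d \<le> energy u u"
    and "energy u u = w0 * D\<^sup>2 / d \<Longrightarrow> i < d \<Longrightarrow> u $ (p ! Suc i) - u $ (p ! i) = D / d"
    and "energy u u = w0 * D\<^sup>2 / d \<Longrightarrow> D \<noteq> 0 \<Longrightarrow> i < d \<Longrightarrow> w {p ! i, p ! Suc i} = w0"
    and "energy u u = w0 * D\<^sup>2 / d \<Longrightarrow> {x, y} \<in> E - path_edges p \<Longrightarrow> u $ x = u $ y"
proof -
  define t where "t i = u $ (p ! Suc i) - u $ (p ! i)" for i
  define W where "W i = w {p ! i, p ! Suc i}" for i
  obtain r where r: "0 \<le> r" "energy u u = (\<Sum>i<d. (t i)\<^sup>2 * W i) + r"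
    "\<And>x y. r = 0 \<Longrightarrow> {x, y} \<in> E - path_edges p \<Longrightarrow> u $ x = u $ y"
    unfolding t_def W_def by (rule energy_split_path[OF p d(1), of u]) blast
  have W: "w0 \<le> W i" if "i < d" for i
    using p d that by (auto simp: W_def graph_path_def intro!: w0)
  have "p \<noteq> []" using d by auto
  have "(\<Sum>i<d. t i) = D"
    unfolding t_def using \<open>p \<noteq> []\<close> d
    by (simp add: sum_lessThan_telescope[of "\<lambda>i. u $ (p ! i)"] D last_conv_nth hd_conv_nth)
  \<comment> \<open>The increments telescope to \<open>D\<close>, so \<open>D / d\<close> is their
    mean and this is the variance expansion.\<close>
  then have "(\<Sum>i<d. (t i - D / d)\<^sup>2) = (\<Sum>i<d. (t i)\<^sup>2) - D\<^sup>2 / d"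
    using d(2)
    by (simp add: power2_diff sum.distrib sum_subtractf sum_distrib_right[symmetric]
        sum_distrib_left[symmetric] sum_divide_distrib[symmetric] power2_eq_square field_simps)
  then have sq: "w0 * (\<Sum>i<d. (t i)\<^sup>2) = w0 * (\<Sum>i<d. (t i - D / d)\<^sup>2) + w0 * D\<^sup>2 / d"
    by (simp add: right_diff_distrib)
  have "(\<Sum>i<d. (t i)\<^sup>2 * W i) = (\<Sum>i<d. (t i)\<^sup>2 * (W i - w0)) + w0 * (\<Sum>i<d. (t i)\<^sup>2)"
    by (simp add: sum_distrib_left sum.distrib[symmetric] algebra_simps)
  with sq r(2) have energy: "energy u u = w0 * D\<^sup>2 / d + (\<Sum>i<d. (t i)\<^sup>2 * (W i - w0))
      + w0 * (\<Sum>i<d. (t i - D / d)\<^sup>2) + r"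
    by simp
  have n1: "0 \<le> (\<Sum>i<d. (t i)\<^sup>2 * (W i - w0))"
    using W by (intro sum_nonneg) auto
  have n2: "0 \<le> w0 * (\<Sum>i<d. (t i - D / d)\<^sup>2)"
    using w0 by (intro mult_nonneg_nonneg sum_nonneg) auto
  show "w0 * D\<^sup>2 / d \<le> energy u u"
    using energy n1 n2 r(1) by linarith
  assume eq: "energy u u = w0 * D\<^sup>2 / d"
  have z: "(\<Sum>i<d. (t i)\<^sup>2 * (W i - w0)) = 0" "w0 * (\<Sum>i<d. (t i - D / d)\<^sup>2) = 0" "r = 0"
    using energy eq n1 n2 r(1) by linarith+
  then have "(\<Sum>i<d. (t i - D / d)\<^sup>2) = 0"
    using w0 by simp
  then have t: "t i = D / d" if "i < d" for i
    using that by (subst (asm) sum_nonneg_eq_0_iff) auto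
  show "i < d \<Longrightarrow> u $ (p ! Suc i) - u $ (p ! i) = D / d"
    using t by (simp add: t_def)
  have "(t i)\<^sup>2 * (W i - w0) = 0" if "i < d" for i
    using z(1) W that by (subst (asm) sum_nonneg_eq_0_iff) auto
  \<comment> \<open>Every increment is \<open>D / d\<close>; the weights are forced only where this
    is nonzero, that is, for \<open>D \<noteq> 0\<close>.\<close>
  then show "D \<noteq> 0 \<Longrightarrow> i < d \<Longrightarrow> w {p ! i, p ! Suc i} = w0"
    using t d by (simp add: W_def)
  show "{x, y} \<in> E - path_edges p \<Longrightarrow> u $ x = u $ y"
    using r(3) z(3) by blast
qed

section \<open>Distances and the boundary diameter\<close>

lemma graph_dist_path:
  obtains p where "path_between E x y p" "length p = Suc (graph_dist E x y)"
proof -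
  obtain q where q: "path_between E x y q"
    using conn by (auto simp: connected_graph_def)
  then have "length q = length q - 1 + 1"
    by (auto simp: path_between_def graph_path_def Suc_le_eq)
  with q have "\<exists>n p. path_between E x y p \<and> length p = n + 1"
    by blast
  from LeastI_ex[OF this] show thesis
    using that unfolding graph_dist_def by auto
qed

lemma graph_dist_pos: "x \<noteq> y \<Longrightarrow> 0 < graph_dist E x y"
proof (rule ccontr)
  assume "x \<noteq> y" "\<not> 0 < graph_dist E x y"
  obtain p where "path_between E x y p" "length p = Suc (graph_dist E x y)"
    by (rule graph_dist_path)
  with \<open>\<not> 0 < graph_dist E x y\<close> have "hd p = x" "last p = y" "length p = Suc 0"
    by (auto simp: path_between_def)
  with \<open>x \<noteq> y\<close> show False
    by (auto simp: length_Suc_conv)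
qed

lemma boundary_distances:
  "{graph_dist E x y | x y. x \<in> B \<and> y \<in> B} = case_prod (graph_dist E) ` (B \<times> B)"
  by auto

lemma graph_dist_le_diameter: "x \<in> B \<Longrightarrow> y \<in> B \<Longrightarrow> graph_dist E x y \<le> boundary_diameter E B"
  unfolding boundary_diameter_def boundary_distances by (rule Max_ge) auto

lemma diameter_path_exists: "\<exists>p. boundary_diameter_path E B p"
proof -
  have "boundary_diameter E B \<in> case_prod (graph_dist E) ` (B \<times> B)"
    unfolding boundary_diameter_def boundary_distances using B_nonempty by (intro Max_in) auto
  then obtain x y where "x \<in> B" "y \<in> B" "boundary_diameter E B = graph_dist E x y"
    by auto
  then show ?thesis
    by (metis graph_dist_path[of x y] path_between_def boundary_diameter_path_def Suc_eq_plus1)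
qed

end

text \<open>For a mean-zero function with values in an interval \<open>[b, a]\<close>, the pointwise inequality
  \<open>(a - f) (f - b) \<ge> 0\<close> integrates to \<open>\<integral> f\<^sup>2 \<le> - a b V\<close>.\<close>

lemma mean_zero_square_bound:
  fixes f \<mu> :: "'a \<Rightarrow> real"
  assumes "\<And>x. x \<in> B \<Longrightarrow> 0 \<le> \<mu> x" "\<And>x. x \<in> B \<Longrightarrow> f x \<le> a" "\<And>x. x \<in> B \<Longrightarrow> b \<le> f x"
    and "(\<Sum>x\<in>B. f x * \<mu> x) = 0"
  shows "(\<Sum>x\<in>B. (f x)\<^sup>2 * \<mu> x) \<le> (a - b)\<^sup>2 / 4 * (\<Sum>x\<in>B. \<mu> x)"
proof -
  have "0 \<le> (\<Sum>x\<in>B. (a - f x) * (f x - b) * \<mu> x)"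
    using assms by (intro sum_nonneg) auto
  also have "\<dots> = (a + b) * (\<Sum>x\<in>B. f x * \<mu> x) - a * b * (\<Sum>x\<in>B. \<mu> x) - (\<Sum>x\<in>B. (f x)\<^sup>2 * \<mu> x)"
    by (simp add: sum_distrib_left sum_subtractf[symmetric] sum.distrib[symmetric]
        power2_eq_square algebra_simps)
  finally have "(\<Sum>x\<in>B. (f x)\<^sup>2 * \<mu> x) \<le> - (a * b) * (\<Sum>x\<in>B. \<mu> x)"
    using assms(4) by simp
  also have "\<dots> \<le> (a - b)\<^sup>2 / 4 * (\<Sum>x\<in>B. \<mu> x)"
  proof (rule mult_right_mono)
    show "- (a * b) \<le> (a - b)\<^sup>2 / 4"
      using zero_le_power2[of "a + b"] by (simp add: power2_eq_square algebra_simps)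
  qed (use assms in \<open>auto intro: sum_nonneg\<close>)
  finally show ?thesis .
qed

section \<open>Paths as connected subgraphs\<close>

lemma set_eq_Union_path_edges:
  assumes "2 \<le> length p"
  shows "set p = \<Union> (path_edges p)"
proof
  show "set p \<subseteq> \<Union> (path_edges p)"
  proof
    fix x assume "x \<in> set p"
    then obtain i where i: "i < length p" "p ! i = x"
      by (auto simp: in_set_conv_nth)
    show "x \<in> \<Union> (path_edges p)"
    proof (cases i)
      case 0
      then show ?thesis using i assms by (auto simp: path_edges_def intro!: exI[of _ "{x, p ! 1}"])
    next
      case (Suc j)
      then show ?thesis using i by (auto simp: path_edges_def intro!: exI[of _ "{p ! j, x}"])
    qed
  qed
qed (auto simp: path_edges_def)

text \<open>Two vertices of a path are joined by the segment between them, read in either direction,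
  using only edges of the path.\<close>

lemma graph_path_sub:
  assumes "graph_path E p" "i \<le> j" "j < length p"
  shows "path_between (path_edges p) (p ! i) (p ! j) (take (Suc j - i) (drop i p))"
    "path_between (path_edges p) (p ! j) (p ! i) (rev (take (Suc j - i) (drop i p)))"
proof -
  let ?q = "take (Suc j - i) (drop i p)"
  have len: "length ?q = Suc j - i" and ne: "?q \<noteq> []"
    using assms by auto
  have nth: "?q ! k = p ! (i + k)" if "k < Suc j - i" for k
    using that assms by simp
  have "distinct ?q"
    using assms by (simp add: graph_path_def)
  have edge: "{?q ! k, ?q ! Suc k} \<in> path_edges p" if "Suc k < Suc j - i" for k
    using that assms by (auto simp: path_edges_def intro!: exI[of _ "i + k"])
  have ends: "hd ?q = p ! i" "last ?q = p ! j"
    using assms ne len by (simp_all add: hd_conv_nth last_conv_nth)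
  show "path_between (path_edges p) (p ! i) (p ! j) ?q"
    using ne \<open>distinct ?q\<close> edge ends len unfolding path_between_def graph_path_def by presburger
  have "{rev ?q ! k, rev ?q ! Suc k} \<in> path_edges p" if "Suc k < Suc j - i" for k
  proof -
    have "rev ?q ! k = ?q ! Suc (j - i - Suc k)" "rev ?q ! Suc k = ?q ! (j - i - Suc k)"
      using that len by (simp_all add: rev_nth Suc_diff_Suc del: nth_take)
    then show ?thesis
      using edge[of "j - i - Suc k"] that by (simp add: insert_commute)
  qed
  then show "path_between (path_edges p) (p ! j) (p ! i) (rev ?q)"
    using ne \<open>distinct ?q\<close> ends len unfolding path_between_def graph_path_def
    by (metis distinct_rev hd_rev last_rev length_rev rev_is_Nil_conv)
qed

lemma connected_path_subgraph:
  assumes "graph_path E p"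
  shows "connected_graph (set p) (path_edges p)"
  unfolding connected_graph_def
proof (intro conjI ballI)
  show "set p \<noteq> {}" using assms by (simp add: graph_path_def)
  fix x y assume "x \<in> set p" "y \<in> set p"
  then obtain i j where "i < length p" "p ! i = x" "j < length p" "p ! j = y"
    by (auto simp: in_set_conv_nth)
  then show "\<exists>q. path_between (path_edges p) x y q"
    using graph_path_sub[OF assms, of i j] graph_path_sub[OF assms, of j i]
    by (cases "i \<le> j") auto
qed

section \<open>The equality case\<close>

context connected_weighted_graph
begin

text \<open>A function attaining the one-dimensional energy bound is injective on the path and constant on
  the components left after deleting the edges of the path.\<close>

lemma comb_over_of_path_energy_eq:
  assumes p: "graph_path E p" and d: "length p = Suc d" "0 < d" and c: "c \<noteq> 0"
    and step: "\<And>i. i < d \<Longrightarrow> u $ (p ! Suc i) - u $ (p ! i) = (c :: real)"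
    and off: "\<And>x y. {x, y} \<in> E - path_edges p \<Longrightarrow> u $ x = u $ y"
  shows "comb_over UNIV E (path_subgraph p)"
proof -
  have sub: "path_edges p \<subseteq> E"
    using p by (auto simp: path_edges_def graph_path_def)
  have E: "simple_graph UNIV E"
    using wgb by (simp add: weighted_graph_with_boundary_def)
  \<comment> \<open>Along \<open>p\<close> the values of \<open>u\<close> form an arithmetic
    progression with nonzero step, hence are pairwise distinct.\<close>
  have lin: "i \<le> d \<Longrightarrow> u $ (p ! i) = u $ (p ! 0) + i * c" for i
  proof (induction i)
    case (Suc i)
    then show ?case using step[of i] by (simp add: algebra_simps)
  qed simp
  have inj: "x = y" if xy: "x \<in> set p" "y \<in> set p" and u: "u $ x = u $ y" for x y
  proof -
    obtain i j where "i \<le> d" "p ! i = x" "j \<le> d" "p ! j = y"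
      using xy d by (auto simp: in_set_conv_nth less_Suc_eq_le)
    then show ?thesis using u lin[of i] lin[of j] c by simp
  qed
  have const: "u $ x = u $ z" if "z \<in> component_of (E - path_edges p) x" for x z
    using that constant_on_path[of "E - path_edges p" "\<lambda>x. u $ x"] off
    by (auto simp: component_of_def)
  \<comment> \<open>A vertex common to both components would give
    \<open>u $ x = u $ y\<close>.\<close>
  have "component_of (E - path_edges p) x \<inter> component_of (E - path_edges p) y = {}"
    if "x \<in> set p" "y \<in> set p" "x \<noteq> y" for x y
    using that const inj by (metis disjoint_iff)
  moreover have "simple_graph (set p) (path_edges p)"
    using E sub d set_eq_Union_path_edges[of p] unfolding simple_graph_def by auto
  ultimately show ?thesis
    using E conn sub connected_path_subgraph[OF p] by (simp add: comb_over_def path_subgraph_def)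
qed

lemma extremal_structure:
  assumes card: "2 \<le> card B"
    and eq: "steklov_eigenvalue E B m w 2 =
      ereal (min_edge_weight E w * boundary_volume B m /
        ((boundary_volume B m - min_boundary_measure B m)\<^sup>2 * real (boundary_diameter E B)))"
  shows "(card B = 2 \<and> (\<forall>x\<in>B. m x = min_boundary_measure B m)) \<and>
    (\<exists>p. boundary_diameter_path E B p \<and>
      (\<forall>q. boundary_diameter_path E B q \<longrightarrow> path_subgraph q = path_subgraph p) \<and>
      (\<forall>i\<in>{1..boundary_diameter E B}. w {p ! (i - 1), p ! i} = min_edge_weight E w) \<and>
      comb_over UNIV E (path_subgraph p))"
proof -
  define w0 m0 V d where "w0 = min_edge_weight E w" and "m0 = min_boundary_measure B m"
    and "V = boundary_volume B m" and "d = boundary_diameter E B"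
  define s where "s = w0 * V / ((V - m0)\<^sup>2 * real d)"
  obtain a b where ab: "a \<in> B" "b \<in> B" "a \<noteq> b"
    using card card_le_Suc0_iff_eq[of B] by fastforce
  \<comment> \<open>Together with \<open>V - m0 > 0\<close> below, this keeps the denominator of
    \<open>s\<close> nonzero, so that division by zero cannot make \<open>s\<close> vanish.\<close>
  have d_pos: "0 < d"
    using graph_dist_pos[OF ab(3)] graph_dist_le_diameter[OF ab(1,2)] by (simp add: d_def)
  obtain p where p: "boundary_diameter_path E B p"
    using diameter_path_exists by blast
  then have "{p ! 0, p ! Suc 0} \<in> E"
    using d_pos by (auto simp: boundary_diameter_path_def graph_path_def d_def)
  then have "E \<noteq> {}" by blast
  have w0: "0 < w0" "w0 \<le> w e" if "e \<in> E" for e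
    using that \<open>E \<noteq> {}\<close> w_pos by (auto simp: w0_def min_edge_weight_def)
  have w0_pos: "0 < w0"
    using w0(1) \<open>E \<noteq> {}\<close> by blast
  have m0: "0 < m0" "m0 \<le> m x" if "x \<in> B" for x
    using that B_nonempty m_pos by (auto simp: m0_def min_boundary_measure_def)
  have m0_pos: "0 < m0"
    using m0(1) B_nonempty by blast
  have "real (card B) * m0 \<le> V"
    unfolding V_def boundary_volume_def using m0(2) sum_bounded_below[of B m0 m] by simp
  moreover have "2 * m0 \<le> real (card B) * m0"
    using card m0_pos by simp
  ultimately have V_ge: "real (card B) * m0 \<le> V" "2 * m0 \<le> V"
    by linarith+
  have V_pos: "0 < V" "0 < V - m0"
    using V_ge m0_pos by linarith+
  have s: "s \<noteq> 0"
    using w0_pos V_pos d_pos by (simp add: s_def)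
  have eig: "steklov_eigenvalue E B m w 2 = ereal s"
    using eq by (simp add: s_def w0_def m0_def V_def d_def)
  obtain f where f: "f \<in> boundary_functions B" "f \<noteq> 0"
    "(\<Sum>x\<in>B. f $ x * m x) = 0" "energy (ext f) (ext f) = s * (\<Sum>x\<in>B. (f $ x)\<^sup>2 * m x)"
    by (rule second_eigenvector[OF card eig s])
  define u where "u = ext f"
  have u: "u $ x = f $ x" if "x \<in> B" for x
    using that by (simp add: u_def ext_boundary)
  define F where "F = (\<Sum>x\<in>B. (f $ x)\<^sup>2 * m x)"
  have energy: "energy u u = s * F"
    using f(4) by (simp add: u_def F_def)
  have F_pos: "0 < F"
    using ip_pos[OF f(1,2)] by (simp add: F_def boundary_inner_def power2_eq_square)

  \<comment> \<open>With \<open>D\<close> the oscillation of \<open>f\<close>, the chain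
    \<open>w0 * D^2 / d \<le> s * F \<le> s * D^2 * V / 4\<close> and the value of \<open>s\<close>
    give \<open>4 * (V - m0)^2 \<le> V^2\<close>.\<close>
  have "V \<le> 2 * m0"
  proof -
    have fin: "finite ((\<lambda>z. f $ z) ` B)" "(\<lambda>z. f $ z) ` B \<noteq> {}"
      using B_nonempty by auto
    obtain x where x: "x \<in> B" "Max ((\<lambda>z. f $ z) ` B) = f $ x"
      using Max_in[OF fin] by (rule imageE) blast
    obtain y where y: "y \<in> B" "Min ((\<lambda>z. f $ z) ` B) = f $ y"
      using Min_in[OF fin] by (rule imageE) blast
    have extrema: "f $ z \<le> f $ x" "f $ y \<le> f $ z" if "z \<in> B" for z
      unfolding x(2)[symmetric] y(2)[symmetric] using that by simp_all
    define D where "D = f $ x - f $ y"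
    have F_le: "F \<le> D\<^sup>2 / 4 * V"
      unfolding F_def D_def V_def boundary_volume_def
      using extrema f(3) m_pos by (intro mean_zero_square_bound) (auto simp: less_imp_le)
    then have "D \<noteq> 0"
      using F_pos by auto
    then have "x \<noteq> y"
      by (auto simp: D_def)
    obtain q where q: "path_between E y x q" "length q = Suc (graph_dist E y x)"
      by (rule graph_dist_path)
    have dist: "0 < graph_dist E y x" "graph_dist E y x \<le> d"
      using graph_dist_pos graph_dist_le_diameter x(1) y(1) \<open>x \<noteq> y\<close> by (auto simp: d_def)
    have "w0 * D\<^sup>2 / d \<le> w0 * D\<^sup>2 / graph_dist E y x"
      using dist w0_pos by (intro divide_left_mono) auto
    also have "\<dots> \<le> s * F"
      unfolding energy[symmetric]
      by (rule path_energy(1)[OF _ q(2) dist(1) w0_pos w0(2)])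
        (use q x(1) y(1) in \<open>auto simp: path_between_def D_def u\<close>)
    also have "\<dots> \<le> s * (D\<^sup>2 / 4 * V)"
      using F_le w0_pos V_pos by (intro mult_left_mono) (auto simp: s_def)
    also have "\<dots> = (w0 * D\<^sup>2 / d) * (V\<^sup>2 / (4 * (V - m0)\<^sup>2))"
      by (simp add: s_def power2_eq_square mult_ac)
    finally have "(w0 * D\<^sup>2 / d) * 1 \<le> (w0 * D\<^sup>2 / d) * (V\<^sup>2 / (4 * (V - m0)\<^sup>2))"
      by (simp only: mult_1_right)
    moreover have "0 < w0 * D\<^sup>2 / d"
      using w0_pos \<open>D \<noteq> 0\<close> d_pos by simp
    ultimately have "1 \<le> V\<^sup>2 / (4 * (V - m0)\<^sup>2)"
      by (simp only: mult_le_cancel_left_pos)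
    moreover have "0 < 4 * (V - m0)\<^sup>2"
      using V_pos(2) by simp
    ultimately have "4 * (V - m0)\<^sup>2 \<le> V\<^sup>2"
      by (simp only: pos_le_divide_eq mult_1_left)
    moreover have "(2 * (V - m0))\<^sup>2 = 4 * (V - m0)\<^sup>2"
      unfolding power_mult_distrib by simp
    ultimately have "2 * (V - m0) \<le> V"
      using power2_le_imp_le[of "2 * (V - m0)" V] V_pos(1) by linarith
    then show ?thesis by simp
  qed
  \<comment> \<open>Now \<open>V = 2 * m0\<close> meets the lower bound \<open>card B * m0\<close>:
    there are two boundary points, both of measure \<open>m0\<close>.\<close>
  with V_ge have V: "V = 2 * m0" by simp
  with V_ge(1) m0_pos have "real (card B) \<le> 2"
    by simp
  with card have card2: "card B = 2" by simp
  then have B: "B = {a, b}"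
    using ab card_subset_eq[of B "{a, b}"] by auto
  then have m: "m a = m0" "m b = m0"
    using V ab m0(2)[of a] m0(2)[of b] by (auto simp: V_def boundary_volume_def)
  have "f $ a * m0 + f $ b * m0 = 0"
    using f(3) B ab m by simp
  then have fb: "f $ b = - f $ a"
    using m0_pos by (simp add: distrib_right[symmetric])
  then have "F = 2 * m0 * (f $ a)\<^sup>2"
    using B ab m by (simp add: F_def)
  then have fa: "f $ a \<noteq> 0" and energy_u: "energy u u = w0 * (2 * f $ a)\<^sup>2 / d"
    using F_pos energy m0_pos by (auto simp: s_def V power2_eq_square)
  \<comment> \<open>The end points are \<open>a\<close> and \<open>b\<close> in some order, so
    \<open>D\<close> is plus or minus \<open>2 * f $ a\<close>. As
    \<open>s * F = 4 * w0 * (f $ a)^2 / d\<close>, every diameter path attains equality.\<close>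
  have step: "\<exists>D. D \<noteq> 0 \<and> D = u $ last q - u $ hd q \<and> energy u u = w0 * D\<^sup>2 / d"
    if "boundary_diameter_path E B q" for q
  proof -
    have q: "distinct q" "length q = Suc d" "hd q \<in> {a, b}" "last q \<in> {a, b}"
      using that B by (auto simp: boundary_diameter_path_def graph_path_def d_def)
    have "q \<noteq> []"
      using q by auto
    then have "hd q \<noteq> last q"
      using q d_pos by (simp add: hd_conv_nth last_conv_nth nth_eq_iff_index_eq)
    with q(3,4) have "u $ last q - u $ hd q \<in> {2 * f $ a, - (2 * f $ a)}"
      using u[OF ab(1)] u[OF ab(2)] fb by auto
    with fa energy_u show ?thesis by auto
  qed
  have path: "graph_path E q" "length q = Suc d" if "boundary_diameter_path E B q" for q
    using that by (auto simp: boundary_diameter_path_def d_def)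
  \<comment> \<open>\<open>u\<close> changes across every edge of \<open>q\<close>, but is constant
    across edges outside \<open>q'\<close>.\<close>
  have edges: "path_edges q \<subseteq> path_edges q'"
    if q: "boundary_diameter_path E B q" and q': "boundary_diameter_path E B q'" for q q'
  proof
    fix e assume "e \<in> path_edges q"
    then obtain i where i: "e = {q ! i, q ! Suc i}" "i < d"
      using path[OF q] by (auto simp: path_edges_def)
    obtain D where D: "D \<noteq> 0" "D = u $ last q - u $ hd q" "energy u u = w0 * D\<^sup>2 / d"
      using step[OF q] by blast
    obtain D' where D': "D' = u $ last q' - u $ hd q'" "energy u u = w0 * D'\<^sup>2 / d"
      using step[OF q'] by blast
    have "u $ (q ! Suc i) - u $ (q ! i) = D / d"
      using path_energy(2)[OF path[OF q] d_pos w0_pos w0(2) D(2,3) i(2)] by simp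
    then have "u $ (q ! i) \<noteq> u $ (q ! Suc i)"
      using D(1) d_pos by auto
    moreover have "e \<in> E"
      using i path[OF q] by (auto simp: graph_path_def)
    ultimately show "e \<in> path_edges q'"
      using path_energy(4)[OF path[OF q'] d_pos w0_pos w0(2) D'] i(1) by blast
  qed
  obtain D where D: "D \<noteq> 0" "D = u $ last p - u $ hd p" "energy u u = w0 * D\<^sup>2 / d"
    using step[OF p] by blast
  note equality = path_energy(2-4)[OF path[OF p] d_pos w0_pos w0(2) D(2,3)]
  have "path_subgraph q = path_subgraph p" if "boundary_diameter_path E B q" for q
  proof -
    \<comment> \<open>Since \<open>d > 0\<close>, the edges also determine the vertices of a
      path.\<close>
    have "path_edges q = path_edges p"
      using edges[OF that p] edges[OF p that] by blast
    then show ?thesis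
      using set_eq_Union_path_edges[of p] set_eq_Union_path_edges[of q] path[OF p] path[OF that]
        d_pos by (simp add: path_subgraph_def)
  qed
  moreover have "w {p ! (i - 1), p ! i} = w0" if "i \<in> {1..d}" for i
    using equality(2)[of "i - 1"] D(1) that by (cases i) auto
  moreover have "comb_over UNIV E (path_subgraph p)"
  proof (rule comb_over_of_path_energy_eq[OF path[OF p] d_pos])
    show "D / d \<noteq> 0"
      using D(1) d_pos by simp
    show "u $ (p ! Suc i) - u $ (p ! i) = D / d" if "i < d" for i
      by (rule equality(1)) (use that in simp_all)
    show "u $ x = u $ y" if "{x, y} \<in> E - path_edges p" for x y
      by (rule equality(3)) (use that in simp_all)
  qed
  moreover have "\<forall>x\<in>B. m x = m0"
    using m B by simp
  ultimately show ?thesis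
    using p card2 unfolding w0_def m0_def d_def by blast
qed

end

theorem theorem1p4:
  fixes E :: "'v::finite set set" and B :: "'v set"
    and m :: "'v \<Rightarrow> real" and w :: "'v set \<Rightarrow> real"
  assumes "weighted_graph_with_boundary E B m w"
    and "connected_graph UNIV E"
    and "steklov_eigenvalue E B m w 2 =
      ereal (min_edge_weight E w * boundary_volume B m /
        ((boundary_volume B m - min_boundary_measure B m)\<^sup>2 * real (boundary_diameter E B)))"
  shows "(card B = 2 \<and> (\<forall>x\<in>B. m x = min_boundary_measure B m)) \<and>
    (\<exists>p. boundary_diameter_path E B p \<and>
      (\<forall>q. boundary_diameter_path E B q \<longrightarrow> path_subgraph q = path_subgraph p) \<and>
      (\<forall>i\<in>{1..boundary_diameter E B}. w {p ! (i - 1), p ! i} = min_edge_weight E w) \<and>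
      comb_over UNIV E (path_subgraph p))"
proof -
  \<comment> \<open>With fewer than two boundary points the eigenvalue is infinite by convention and
    cannot equal a real number.\<close>
  have card: "2 \<le> card B"
    using assms(3) by (auto simp: steklov_eigenvalue_def split: if_splits)
  then interpret connected_weighted_graph E B m w
    using assms(1,2) by unfold_locales auto
  show ?thesis
    using extremal_structure[OF card assms(3)] .
qed

end
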